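(* Let $(\Omega,\mathcal{F},\mathbb{P})$ be a probability space, let $\mu$ be a (Borel) probability measure on $[0,1]$ and let $S=(S_0,S_1)$ be an eligible asset. The risk measure $S\text{-}\mathrm{DR}_\mu$ is comonotonic if and only if one of the following conditions holds: (i) $\mu(\{1\})=1$ (so that $\mathrm{DR}_\mu(X)=-\mathbb{E}[X]$ for all $X\in L^\infty$). (ii) $S$ is risk-free.
   Context: $L^\infty=L^\infty(\Omega,\mathcal{F},\mathbb{P})$ is the space of (a.s.-equivalence classes of) essentially bounded real random variables, and $L^\infty_+=\{X\in L^\infty : X\ge 0 \text{ a.s.}\}$. An eligible asset is a pair $S=(S_0,S_1)\in(0,\infty)\times L^\infty_+$ with $S_1\ge\varepsilon$ a.s. for some constant $\varepsilon>0$; $S$ is risk-free if $S_1$ is (a.s.) constant. For $\beta\in(0,1)$ and $X\in L^\infty$, $\mathrm{VaR}_\beta(X)=\inf\{m\in\mathbb{R} : \mathbb{P}(X+m<0)\leq\beta\}$. For $\alpha\in(0,1)$, $\mathrm{ES}_\alpha(X)=\frac{1}{\alpha}\int_0^\alpha\mathrm{VaR}_\beta(X)\,d\beta$; moreover $\mathrm{ES}_0(X)=-\sup\{m\in\mathbb{R} : X\ge m \text{ a.s.}\}$ (minus the essential infimum of $X$) and $\mathrm{ES}_1(X)=-\mathbb{E}[X]$. The distortion risk measure associated with $\mu$ is $\mathrm{DR}_\mu(X)=\int_{[0,1]}\mathrm{ES}_\alpha(X)\,\mu(d\alpha)$, and $S\text{-}\mathrm{DR}_\mu:L^\infty\to\mathbb{R}$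 is defined by $S\text{-}\mathrm{DR}_\mu(X)=\inf\{m\in\mathbb{R} : \mathrm{DR}_\mu(X+\tfrac{m}{S_0}S_1)\leq0\}$. Two random variables $X,Y\in L^\infty$ are comonotone if there is a $\mathbb{P}\otimes\mathbb{P}$-null set $N$ such that $(X(\omega)-X(\omega'))(Y(\omega)-Y(\omega'))\ge0$ for all $(\omega,\omega')\in(\Omega\times\Omega)\setminus N$. A functional $\rho:L^\infty\to\mathbb{R}$ is comonotonic if $\rho(X+Y)=\rho(X)+\rho(Y)$ for all comonotone $X,Y\in L^\infty$. *)

theory Defs
  imports "HOL-Probability.Probability"
begin

text \<open>
  Elements of \<open>L\<^sup>\<infinity>\<close> are represented by measurable, essentially bounded functions.
  All notions below depend only on the a.s.-equivalence class of these representatives;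
  see \<open>S_DR_cong_AE\<close> for the risk measure itself.
\<close>

definition Linf :: "'a measure \<Rightarrow> ('a \<Rightarrow> real) set" where
  "Linf M = {X \<in> borel_measurable M. \<exists>C. AE \<omega> in M. \<bar>X \<omega>\<bar> \<le> C}"

definition Linf_plus :: "'a measure \<Rightarrow> ('a \<Rightarrow> real) set" where
  "Linf_plus M = {X \<in> Linf M. AE \<omega> in M. 0 \<le> X \<omega>}"

definition eligible_asset :: "'a measure \<Rightarrow> real \<times> ('a \<Rightarrow> real) \<Rightarrow> bool" where
  "eligible_asset M S \<longleftrightarrow>
     0 < fst S \<and> snd S \<in> Linf_plus M \<and> (\<exists>\<epsilon>>0. AE \<omega> in M. \<epsilon> \<le> snd S \<omega>)"

definition risk_free :: "'a measure \<Rightarrow> real \<times> ('a \<Rightarrow> real) \<Rightarrow> bool" where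
  "risk_free M S \<longleftrightarrow> (\<exists>c. AE \<omega> in M. snd S \<omega> = c)"

definition VaR :: "'a measure \<Rightarrow> real \<Rightarrow> ('a \<Rightarrow> real) \<Rightarrow> real" where
  "VaR M \<beta> X = Inf {m. measure M {\<omega> \<in> space M. X \<omega> + m < 0} \<le> \<beta>}"

text \<open>Only the values for \<open>\<alpha>\<close> in \<open>[0,1]\<close> are meaningful.\<close>

definition ES :: "'a measure \<Rightarrow> real \<Rightarrow> ('a \<Rightarrow> real) \<Rightarrow> real" where
  "ES M \<alpha> X =
     (if \<alpha> = 0 then - Sup {m. AE \<omega> in M. m \<le> X \<omega>}
      else if \<alpha> = 1 then - (\<integral>\<omega>. X \<omega> \<partial>M)
      else 1 / \<alpha> * (LBINT \<beta>:{0<..<\<alpha>}. VaR M \<beta> X))"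

definition borel_prob_unit :: "real measure \<Rightarrow> bool" where
  "borel_prob_unit \<mu> \<longleftrightarrow> prob_space \<mu> \<and> sets \<mu> = sets (restrict_space borel {0..1})"

definition DR :: "'a measure \<Rightarrow> real measure \<Rightarrow> ('a \<Rightarrow> real) \<Rightarrow> real" where
  "DR M \<mu> X = (\<integral>\<alpha>. ES M \<alpha> X \<partial>\<mu>)"

definition S_DR ::
  "'a measure \<Rightarrow> real \<times> ('a \<Rightarrow> real) \<Rightarrow> real measure \<Rightarrow> ('a \<Rightarrow> real) \<Rightarrow> real" where
  "S_DR M S \<mu> X = Inf {m. DR M \<mu> (\<lambda>\<omega>. X \<omega> + m / fst S * snd S \<omega>) \<le> 0}"

definition comonotone :: "'a measure \<Rightarrow> ('a \<Rightarrow> real) \<Rightarrow> ('a \<Rightarrow> real) \<Rightarrow> bool" where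
  "comonotone M X Y \<longleftrightarrow>
     (\<exists>N \<in> null_sets (M \<Otimes>\<^sub>M M). \<forall>(\<omega>, \<omega>') \<in> (space M \<times> space M) - N.
        (X \<omega> - X \<omega>') * (Y \<omega> - Y \<omega>') \<ge> 0)"

definition comonotonic :: "'a measure \<Rightarrow> (('a \<Rightarrow> real) \<Rightarrow> real) \<Rightarrow> bool" where
  "comonotonic M \<rho> \<longleftrightarrow>
     (\<forall>X \<in> Linf M. \<forall>Y \<in> Linf M. comonotone M X Y \<longrightarrow> \<rho> (\<lambda>\<omega>. X \<omega> + Y \<omega>) = \<rho> X + \<rho> Y)"

lemma VaR_cong_AE:
  assumes [measurable]: "X \<in> borel_measurable M" "Y \<in> borel_measurable M"
    and eq: "AE \<omega> in M. X \<omega> = Y \<omega>"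
  shows "VaR M \<beta> X = VaR M \<beta> Y"
proof -
  have "measure M {\<omega> \<in> space M. X \<omega> + m < 0} = measure M {\<omega> \<in> space M. Y \<omega> + m < 0}" for m
    by (rule measure_eq_AE) (use eq in auto)
  then show ?thesis by (simp add: VaR_def)
qed

lemma ES_cong_AE:
  assumes [measurable]: "X \<in> borel_measurable M" "Y \<in> borel_measurable M"
    and eq: "AE \<omega> in M. X \<omega> = Y \<omega>"
  shows "ES M \<alpha> X = ES M \<alpha> Y"
proof -
  have "(AE \<omega> in M. m \<le> X \<omega>) \<longleftrightarrow> (AE \<omega> in M. m \<le> Y \<omega>)" for m
    by (rule eventually_subst) (use eq in \<open>auto elim: eventually_mono\<close>)
  moreover have "(\<integral>\<omega>. X \<omega> \<partial>M) = (\<integral>\<omega>. Y \<omega> \<partial>M)"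
    by (rule integral_cong_AE) (use eq in auto)
  ultimately show ?thesis
    using VaR_cong_AE[OF assms] by (simp add: ES_def)
qed

lemma S_DR_cong_AE:
  assumes [measurable]: "X \<in> borel_measurable M" "Y \<in> borel_measurable M"
      "snd S \<in> borel_measurable M" "snd T \<in> borel_measurable M"
    and "AE \<omega> in M. X \<omega> = Y \<omega>"
    and "fst S = fst T" "AE \<omega> in M. snd S \<omega> = snd T \<omega>"
  shows "S_DR M S \<mu> X = S_DR M T \<mu> Y"
proof -
  have "ES M \<alpha> (\<lambda>\<omega>. X \<omega> + m / fst S * snd S \<omega>) = ES M \<alpha> (\<lambda>\<omega>. Y \<omega> + m / fst T * snd T \<omega>)"
    for \<alpha> m
    by (rule ES_cong_AE) (use assms in \<open>auto elim!: eventually_elim2\<close>)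
  then show ?thesis by (simp add: S_DR_def DR_def)
qed

end

theory Submission
  imports Defs
begin

text \<open>
  Value at risk is comonotonic additive because the lower level sets of comonotone variables are
  nested up to null sets; integration passes this on to \<open>DR\<close>. In both cases (i) and (ii), \<open>S_DR\<close> is a
  multiple of \<open>DR\<close>, hence comonotonic. Conversely, additivity on the comonotone constants \<open>1\<close> and
  \<open>- 1\<close> forces \<open>DR(S\<^sub>1) + DR(- S\<^sub>1) = 0\<close>. For non-constant \<open>X\<close> and \<open>\<alpha> < 1\<close>, however, the expected
  shortfall of \<open>X\<close> strictly exceeds \<open>- E[X]\<close>, so that \<open>ES\<^sub>\<alpha>(S\<^sub>1) + ES\<^sub>\<alpha>(- S\<^sub>1) > 0\<close>; if \<open>S\<^sub>1\<close> is not constant,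
  \<open>\<mu>\<close> must therefore be concentrated at \<open>1\<close>.
\<close>

section \<open>Essentially bounded random variables\<close>

lemma Linf_measurable [measurable_dest]: "X \<in> Linf M \<Longrightarrow> X \<in> borel_measurable M"
  by (simp add: Linf_def)

lemma Linf_bounded:
  assumes "X \<in> Linf M"
  obtains C where "AE \<omega> in M. \<bar>X \<omega>\<bar> \<le> C"
  using assms by (auto simp: Linf_def)

lemma Linf_const: "(\<lambda>_. c) \<in> Linf M"
  by (auto simp: Linf_def intro!: exI[of _ "\<bar>c\<bar>"])

lemma Linf_cmult:
  assumes "X \<in> Linf M"
  shows "(\<lambda>\<omega>. c * X \<omega>) \<in> Linf M"
proof -
  obtain C where "AE \<omega> in M. \<bar>X \<omega>\<bar> \<le> C"
    using assms by (rule Linf_bounded)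
  then have "AE \<omega> in M. \<bar>c * X \<omega>\<bar> \<le> \<bar>c\<bar> * C"
    by eventually_elim (simp add: abs_mult mult_left_mono)
  then show ?thesis
    using assms by (auto simp: Linf_def)
qed

lemma Linf_add:
  assumes "X \<in> Linf M" "Y \<in> Linf M"
  shows "(\<lambda>\<omega>. X \<omega> + Y \<omega>) \<in> Linf M"
proof -
  obtain C D where "AE \<omega> in M. \<bar>X \<omega>\<bar> \<le> C" "AE \<omega> in M. \<bar>Y \<omega>\<bar> \<le> D"
    using assms by (auto simp: Linf_def)
  then have "AE \<omega> in M. \<bar>X \<omega> + Y \<omega>\<bar> \<le> C + D"
    by eventually_elim linarith
  then show ?thesis
    using assms by (auto simp: Linf_def)
qed

lemma comonotone_const: "comonotone M X (\<lambda>_. c)"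
  by (auto simp: comonotone_def intro!: bexI[of _ "{}"])

context prob_space
begin

lemma Linf_integrable: "X \<in> Linf M \<Longrightarrow> integrable M X"
  by (auto simp: Linf_def intro!: integrable_const_bound)

section \<open>Value at risk as a quantile, and its additivity on comonotone pairs\<close>

text \<open>The infimum defining \<open>VaR\<close> is attained: \<open>1 - prob {X + x < 0}\<close>
  is the distribution function of \<open>- X\<close> at \<open>x\<close>, which is right-continuous.
  The resulting equivalence reduces questions about \<open>VaR\<close> to probabilities of lower
  level sets. Level 0 is included so that the essential infimum can be handled in the same
  way.\<close>

lemma VaR_le_iff:
  assumes X: "X \<in> Linf M" and \<beta>: "0 \<le> \<beta>" "\<beta> < 1"
  shows "VaR M \<beta> X \<le> m \<longleftrightarrow> prob {\<omega> \<in> space M. X \<omega> + m < 0} \<le> \<beta>"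
proof -
  note X[measurable]
  let ?N = "distr M borel (\<lambda>\<omega>. - X \<omega>)"
  interpret N: real_distribution ?N
    by simp
  let ?F = "cdf ?N"
  have F: "prob {\<omega> \<in> space M. X \<omega> + x < 0} = 1 - ?F x" for x
  proof -
    have "?F x = prob {\<omega> \<in> space M. - X \<omega> \<le> x}"
      by (simp add: cdf_def measure_distr vimage_def Int_def conj_commute)
    also have "\<dots> = 1 - prob {\<omega> \<in> space M. \<not> - X \<omega> \<le> x}"
      by (subst prob_neg) auto
    also have "{\<omega> \<in> space M. \<not> - X \<omega> \<le> x} = {\<omega> \<in> space M. X \<omega> + x < 0}"
      by auto
    finally show ?thesis by simp
  qed
  let ?A = "{x. prob {\<omega> \<in> space M. X \<omega> + x < 0} \<le> \<beta>}"
  have A: "x \<in> ?A \<longleftrightarrow> 1 - \<beta> \<le> ?F x" for x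
    by (auto simp: F)
  obtain C where C: "AE \<omega> in M. \<bar>X \<omega>\<bar> \<le> C"
    using X by (rule Linf_bounded)
  have "prob {\<omega> \<in> space M. X \<omega> + C < 0} = prob {}"
    by (rule finite_measure_eq_AE) (use C in auto)
  with \<beta> have "C \<in> ?A"
    by simp
  then have ne: "?A \<noteq> {}"
    by blast
  have "eventually (\<lambda>x. ?F x < 1 - \<beta>) at_bot"
    using N.cdf_lim_at_bot by (rule order_tendstoD) (use \<beta> in simp)
  \<comment> \<open>The point \<open>y\<close> bounds \<open>?A\<close> from below: members of
    \<open>?A\<close> have a larger value of the monotone \<open>?F\<close>.\<close>
  from eventually_happens'[OF trivial_limit_at_bot_linorder this]
  obtain y where y: "?F y < 1 - \<beta>" ..
  have bdd: "bdd_below ?A"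
  proof (rule bdd_belowI)
    fix x
    assume "x \<in> ?A"
    then have "?F y < ?F x"
      using y by (simp add: F)
    then show "y \<le> x"
      using N.cdf_nondecreasing[of x y] by linarith
  qed
  have mono: "mono ?F"
    by (auto intro: monoI N.cdf_nondecreasing)
  show ?thesis
  proof
    assume *: "VaR M \<beta> X \<le> m"
    \<comment> \<open>Right-continuity moves the infimum inside \<open>?F\<close>, so
      \<open>Inf ?A\<close> itself satisfies the inequality that defines \<open>?A\<close>.\<close>
    have "1 - \<beta> \<le> (INF s\<in>?A. ?F s)"
      by (rule cINF_greatest[OF ne]) (simp add: F)
    also have "\<dots> = ?F (Inf ?A)"
      using continuous_at_Inf_mono[OF mono N.cdf_is_right_cont ne bdd] ..
    also have "\<dots> \<le> ?F m"
      using * by (auto simp: VaR_def intro: N.cdf_nondecreasing)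
    finally show "prob {\<omega> \<in> space M. X \<omega> + m < 0} \<le> \<beta>"
      by (simp add: F)
  next
    assume "prob {\<omega> \<in> space M. X \<omega> + m < 0} \<le> \<beta>"
    then show "VaR M \<beta> X \<le> m"
      unfolding VaR_def using bdd by (intro cInf_lower) auto
  qed
qed

lemma VaR_bounds:
  assumes X: "X \<in> Linf M" and \<beta>: "0 \<le> \<beta>" "\<beta> < 1"
    and a: "AE \<omega> in M. a \<le> X \<omega>" and b: "AE \<omega> in M. X \<omega> \<le> b"
  shows "VaR M \<beta> X \<in> {- b..- a}"
proof -
  note X[measurable]
  have "prob {\<omega> \<in> space M. X \<omega> + - a < 0} = prob {}"
    by (rule finite_measure_eq_AE) (use a in auto)
  then have "VaR M \<beta> X \<le> - a"
    using X \<beta> by (simp add: VaR_le_iff)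
  moreover have "- b \<le> VaR M \<beta> X"
  proof (rule ccontr)
    assume *: "\<not> - b \<le> VaR M \<beta> X"
    \<comment> \<open>If \<open>VaR\<close> were below \<open>- b\<close>, then
      \<open>X + VaR\<close> would be negative almost surely, an event of probability 1 instead of
      at most \<beta>.\<close>
    have "prob {\<omega> \<in> space M. X \<omega> + VaR M \<beta> X < 0} = prob (space M)"
      by (rule finite_measure_eq_AE) (use b * in auto)
    moreover have "prob {\<omega> \<in> space M. X \<omega> + VaR M \<beta> X < 0} \<le> \<beta>"
      using X \<beta> VaR_le_iff by blast
    ultimately show False
      using \<beta> by (simp add: prob_space)
  qed
  ultimately show ?thesis by simp
qed

lemma VaR_abs_le:
  assumes "X \<in> Linf M" "0 \<le> \<beta>" "\<beta> < 1" "AE \<omega> in M. \<bar>X \<omega>\<bar> \<le> C"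
  shows "\<bar>VaR M \<beta> X\<bar> \<le> C"
proof -
  have "AE \<omega> in M. - C \<le> X \<omega>" "AE \<omega> in M. X \<omega> \<le> C"
    using assms(4) by (auto elim!: eventually_mono)
  from VaR_bounds[OF assms(1-3) this] show ?thesis
    by (simp add: abs_le_iff)
qed

lemma VaR_antimono:
  assumes "X \<in> Linf M" "0 \<le> \<beta>" "\<beta> \<le> \<gamma>" "\<gamma> < 1"
  shows "VaR M \<gamma> X \<le> VaR M \<beta> X"
  using assms VaR_le_iff[of X \<beta> "VaR M \<beta> X"] VaR_le_iff[of X \<gamma> "VaR M \<beta> X"] by auto

lemma VaR_cmult:
  assumes "X \<in> Linf M" "0 \<le> \<beta>" "\<beta> < 1" "0 < c"
  shows "VaR M \<beta> (\<lambda>\<omega>. c * X \<omega>) = c * VaR M \<beta> X"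
proof -
  \<comment> \<open>Two reals with the same upper bounds are equal; this form suits
    \<open>VaR_le_iff\<close>.\<close>
  have "VaR M \<beta> (\<lambda>\<omega>. c * X \<omega>) \<le> m \<longleftrightarrow> c * VaR M \<beta> X \<le> m" for m
  proof -
    have "{\<omega> \<in> space M. c * X \<omega> + m < 0} = {\<omega> \<in> space M. X \<omega> + m / c < 0}"
      using \<open>0 < c\<close> by (auto simp: field_simps)
    then have "VaR M \<beta> (\<lambda>\<omega>. c * X \<omega>) \<le> m \<longleftrightarrow> VaR M \<beta> X \<le> m / c"
      using assms by (simp add: VaR_le_iff Linf_cmult)
    then show ?thesis
      using \<open>0 < c\<close> by (simp add: field_simps)
  qed
  then show ?thesis by (meson order_antisym order_refl)
qed

text \<open>For comonotone variables the product of the two set differences is a null set.\<close>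

lemma comonotone_nested:
  assumes [measurable]: "X \<in> borel_measurable M" "Y \<in> borel_measurable M"
    and "comonotone M X Y"
  shows "prob ({\<omega> \<in> space M. X \<omega> < s} - {\<omega> \<in> space M. Y \<omega> < t}) = 0
    \<or> prob ({\<omega> \<in> space M. Y \<omega> < t} - {\<omega> \<in> space M. X \<omega> < s}) = 0"
proof -
  let ?A = "{\<omega> \<in> space M. X \<omega> < s} - {\<omega> \<in> space M. Y \<omega> < t}"
  let ?B = "{\<omega> \<in> space M. Y \<omega> < t} - {\<omega> \<in> space M. X \<omega> < s}"
  obtain N where N: "N \<in> null_sets (M \<Otimes>\<^sub>M M)"
    and como: "\<And>\<omega> \<omega>'. \<omega> \<in> space M \<Longrightarrow> \<omega>' \<in> space M \<Longrightarrow> (\<omega>, \<omega>') \<notin> N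
      \<Longrightarrow> (X \<omega> - X \<omega>') * (Y \<omega> - Y \<omega>') \<ge> 0"
    using assms(3) unfolding comonotone_def by blast
  have "?A \<times> ?B \<subseteq> N"
  proof
    fix z
    assume "z \<in> ?A \<times> ?B"
    then obtain \<omega> \<omega>' where z: "z = (\<omega>, \<omega>')" and "\<omega> \<in> ?A" "\<omega>' \<in> ?B"
      by blast
    then have in_space: "\<omega> \<in> space M" "\<omega>' \<in> space M"
      and less: "X \<omega> < s" "s \<le> X \<omega>'" "Y \<omega>' < t" "t \<le> Y \<omega>"
      by (simp_all add: not_less)
    from less have "(X \<omega> - X \<omega>') * (Y \<omega> - Y \<omega>') < 0"
      by (intro mult_neg_pos) auto
    then show "z \<in> N"
      using como[OF in_space] z by auto
  qed
  then have "emeasure (M \<Otimes>\<^sub>M M) (?A \<times> ?B) = 0"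
    using N by (auto intro: emeasure_eq_0)
  moreover have "emeasure (M \<Otimes>\<^sub>M M) (?A \<times> ?B) = emeasure M ?A * emeasure M ?B"
    by (rule emeasure_pair_measure_Times) auto
  ultimately show ?thesis
    by (auto simp: measure_def)
qed

text \<open>Up to a null set, one of the level sets \<open>{X < s}\<close> and
  \<open>{Y < t}\<close> contains the other. Hence their union has the larger of the two
  probabilities and their intersection the smaller. The union yields the upper bound for the sum,
  the intersection the lower one.\<close>

lemma VaR_comonotone_add:
  assumes X: "X \<in> Linf M" and Y: "Y \<in> Linf M" and como: "comonotone M X Y"
    and \<beta>: "0 \<le> \<beta>" "\<beta> < 1"
  shows "VaR M \<beta> (\<lambda>\<omega>. X \<omega> + Y \<omega>) = VaR M \<beta> X + VaR M \<beta> Y"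
proof (rule antisym)
  note X[measurable] Y[measurable]
  let ?A = "\<lambda>s. {\<omega> \<in> space M. X \<omega> < s}" and ?B = "\<lambda>t. {\<omega> \<in> space M. Y \<omega> < t}"
  have nested: "prob (?A s - ?B t) = 0 \<or> prob (?B t - ?A s) = 0" for s t
    using como by (intro comonotone_nested) auto
  have VaR_X: "VaR M \<beta> X \<le> m \<longleftrightarrow> prob (?A (- m)) \<le> \<beta>"
    and VaR_Y: "VaR M \<beta> Y \<le> m \<longleftrightarrow> prob (?B (- m)) \<le> \<beta>" for m
  proof -
    have "z < - m \<longleftrightarrow> z + m < 0" for z :: real
      by linarith
    then show "VaR M \<beta> X \<le> m \<longleftrightarrow> prob (?A (- m)) \<le> \<beta>"
      and "VaR M \<beta> Y \<le> m \<longleftrightarrow> prob (?B (- m)) \<le> \<beta>"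
      using VaR_le_iff[OF X \<beta>, of m] VaR_le_iff[OF Y \<beta>, of m] by simp_all
  qed
  have XY: "(\<lambda>\<omega>. X \<omega> + Y \<omega>) \<in> Linf M"
    using X Y by (rule Linf_add)
  let ?p = "VaR M \<beta> X" and ?q = "VaR M \<beta> Y"
  \<comment> \<open>A sum below \<open>- (?p + ?q)\<close> forces \<open>X < - ?p\<close> or
    \<open>Y < - ?q\<close>.\<close>
  have "prob {\<omega> \<in> space M. X \<omega> + Y \<omega> + (?p + ?q) < 0} \<le> prob (?A (- ?p) \<union> ?B (- ?q))"
    by (intro finite_measure_mono) auto
  also have "\<dots> \<le> \<beta>"
    using nested[of "- ?p" "- ?q"]
  proof
    assume "prob (?A (- ?p) - ?B (- ?q)) = 0"
    then have "prob (?A (- ?p) \<union> ?B (- ?q)) = prob (?B (- ?q))"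
      by (subst Un_commute, subst finite_measure_Union') auto
    then show ?thesis
      using VaR_Y by auto
  next
    assume "prob (?B (- ?q) - ?A (- ?p)) = 0"
    then have "prob (?A (- ?p) \<union> ?B (- ?q)) = prob (?A (- ?p))"
      by (subst finite_measure_Union') auto
    then show ?thesis
      using VaR_X by auto
  qed
  finally show "VaR M \<beta> (\<lambda>\<omega>. X \<omega> + Y \<omega>) \<le> ?p + ?q"
    using VaR_le_iff[OF XY \<beta>] by simp
  show "?p + ?q \<le> VaR M \<beta> (\<lambda>\<omega>. X \<omega> + Y \<omega>)" (is "_ \<le> ?v")
  proof (rule ccontr)
    assume "\<not> ?p + ?q \<le> ?v"
    \<comment> \<open>The gap between \<open>?p + ?q\<close> and \<open>?v\<close> is shared
      equally: \<open>p + q\<close> equals \<open>?v\<close>, while \<open>p\<close> and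
      \<open>q\<close> lie strictly below the two quantiles, so both level sets have probability
      above \<beta>.\<close>
    moreover define p where "p = ?p - (?p + ?q - ?v) / 2"
    moreover define q where "q = ?q - (?p + ?q - ?v) / 2"
    ultimately have p: "p < ?p" and q: "q < ?q" and v: "?v \<le> p + q"
      by (simp_all add: field_simps)
    have "\<beta> < prob (?A (- p) \<inter> ?B (- q))"
      using nested[of "- p" "- q"]
    proof
      assume "prob (?A (- p) - ?B (- q)) = 0"
      then have "prob (?A (- p) \<inter> ?B (- q)) = prob (?A (- p))"
        using finite_measure_Diff'[of "?A (- p)" "?B (- q)"] by auto
      then show ?thesis
        using VaR_X[of p] p by auto
    next
      assume "prob (?B (- q) - ?A (- p)) = 0"
      then have "prob (?A (- p) \<inter> ?B (- q)) = prob (?B (- q))"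
        using finite_measure_Diff'[of "?B (- q)" "?A (- p)"] by (auto simp: Int_commute)
      then show ?thesis
        using VaR_Y[of q] q by auto
    qed
    also have "\<dots> \<le> prob {\<omega> \<in> space M. X \<omega> + Y \<omega> + (p + q) < 0}"
      by (intro finite_measure_mono) auto
    also have "\<dots> \<le> \<beta>"
      using v VaR_le_iff[OF XY \<beta>] by simp
    finally show False by simp
  qed
qed

section \<open>Value at risk as a function of the level: law and integrals\<close>

lemma VaR_measurable:
  assumes X: "X \<in> Linf M"
  shows "(\<lambda>\<beta>. VaR M \<beta> X) \<in> borel_measurable (restrict_space borel {0<..<1})"
proof -
  have "mono_on {0<..<1} (\<lambda>\<beta>. - VaR M \<beta> X)"
    by (auto intro!: mono_onI VaR_antimono X)
  from borel_measurable_mono_on_fnc[OF this] show ?thesis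
    by simp
qed

text \<open>This is inverse transform sampling: at a uniformly distributed level, \<open>VaR\<close>
  has the law of \<open>- X\<close>. By \<open>VaR_le_iff\<close>, the levels at which
  \<open>VaR\<close> is at most \<open>x\<close> are those with \<open>p \<le> \<beta>\<close>, a
  set of Lebesgue measure \<open>1 - p\<close>.\<close>

lemma distr_VaR:
  assumes X: "X \<in> Linf M"
  shows "distr (restrict_space lborel {0<..<1}) borel (\<lambda>\<beta>. VaR M \<beta> X) = distr M borel (\<lambda>\<omega>. - X \<omega>)"
    (is "distr ?U _ _ = _")
proof -
  note X[measurable]
  interpret U: prob_space ?U
    by (auto simp: emeasure_restrict_space space_restrict_space intro!: prob_spaceI)
  have [measurable]: "(\<lambda>\<beta>. VaR M \<beta> X) \<in> borel_measurable ?U"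
    using VaR_measurable[OF X] by (simp cong: measurable_cong_sets sets_restrict_space_cong)
  show ?thesis
  proof (intro cdf_unique ext)
    fix x
    define p where "p = prob {\<omega> \<in> space M. X \<omega> + x < 0}"
    then have p: "0 \<le> p" "p \<le> 1"
      by simp_all
    have "cdf (distr ?U borel (\<lambda>\<beta>. VaR M \<beta> X)) x = measure lborel {\<beta> \<in> {0<..<1}. p \<le> \<beta>}"
      by (subst cdf_def)
        (auto simp: p_def VaR_le_iff[OF X, symmetric] measure_distr space_restrict_space
          measure_restrict_space intro!: arg_cong2[where f="measure"])
    \<comment> \<open>The two sets can differ only at the point 0, namely when
      \<open>p = 0\<close>.\<close>
    also have "\<dots> = measure lborel {p..<1}"
    proof (rule measure_eq_AE)
      show "AE \<beta> in lborel. \<beta> \<in> {\<beta> \<in> {0<..<1}. p \<le> \<beta>} \<longleftrightarrow> \<beta> \<in> {p..<1}"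
        using AE_lborel_singleton[of 0]
        by eventually_elim (use p in \<open>auto simp: less_le\<close>)
    qed auto
    also have "\<dots> = 1 - p"
      using p by simp
    also have "\<dots> = prob {\<omega> \<in> space M. \<not> X \<omega> + x < 0}"
      unfolding p_def by (subst prob_neg) auto
    also have "\<dots> = cdf (distr M borel (\<lambda>\<omega>. - X \<omega>)) x"
      by (auto simp: cdf_def measure_distr intro!: arg_cong[where f=prob])
    finally show "cdf (distr ?U borel (\<lambda>\<beta>. VaR M \<beta> X)) x = cdf (distr M borel (\<lambda>\<omega>. - X \<omega>)) x" .
  qed auto
qed

lemma integral_VaR:
  fixes f :: "real \<Rightarrow> real"
  assumes X: "X \<in> Linf M" and [measurable]: "f \<in> borel_measurable borel"
  shows "(LBINT \<beta>:{0<..<1}. f (VaR M \<beta> X)) = (\<integral>\<omega>. f (- X \<omega>) \<partial>M)"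
proof -
  note X[measurable] VaR_measurable[OF X, measurable]
  have [measurable]: "(\<lambda>\<beta>. VaR M \<beta> X) \<in> borel_measurable (restrict_space lborel {0<..<1})"
    by (simp cong: measurable_cong_sets sets_restrict_space_cong)
  have "(LBINT \<beta>:{0<..<1}. f (VaR M \<beta> X)) = (\<integral>\<beta>. f (VaR M \<beta> X) \<partial>restrict_space lborel {0<..<1})"
    by (simp add: set_lebesgue_integral_def integral_restrict_space)
  also have "\<dots> = (\<integral>x. f x \<partial>distr (restrict_space lborel {0<..<1}) borel (\<lambda>\<beta>. VaR M \<beta> X))"
    by (simp add: integral_distr)
  also have "\<dots> = (\<integral>\<omega>. f (- X \<omega>) \<partial>M)"
    by (simp add: distr_VaR[OF X] integral_distr)
  finally show ?thesis .
qed

lemma VaR_set_integrable: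
  assumes X: "X \<in> Linf M" and "\<alpha> \<le> 1"
  shows "set_integrable lborel {0<..<\<alpha>} (\<lambda>\<beta>. VaR M \<beta> X)"
proof -
  obtain C where C: "AE \<omega> in M. \<bar>X \<omega>\<bar> \<le> C"
    using X by (rule Linf_bounded)
  \<comment> \<open>Cutting \<open>VaR\<close> off outside the open unit interval gives a function
    measurable on the whole line; it agrees with \<open>VaR\<close> on the domain of integration
    because \<open>\<alpha> \<le> 1\<close>.\<close>
  let ?g = "\<lambda>\<beta>. indicator {0<..<1} \<beta> * VaR M \<beta> X"
  have "set_integrable lborel {0<..<\<alpha>} ?g"
    unfolding set_integrable_def
  proof (rule integrableI_bounded_set_indicator[where B=C])
    show "?g \<in> borel_measurable lborel"
      using VaR_measurable[OF X] by (simp add: borel_measurable_restrict_space_iff)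
    show "AE \<beta> in lborel. \<beta> \<in> {0<..<\<alpha>} \<longrightarrow> norm (?g \<beta>) \<le> C"
      using VaR_abs_le[OF X _ _ C] \<open>\<alpha> \<le> 1\<close> by auto
    show "emeasure lborel {0<..<\<alpha>} < \<infinity>"
      by (cases "0 \<le> \<alpha>") auto
  qed auto
  moreover have "set_integrable lborel {0<..<\<alpha>} ?g \<longleftrightarrow> ?thesis"
    by (rule set_integrable_cong) (use \<open>\<alpha> \<le> 1\<close> in auto)
  ultimately show ?thesis by blast
qed

section \<open>Expected shortfall\<close>

text \<open>A level set of probability 0 is an almost sure lower bound in disguise. The separately
  defined value at level 0 thereby becomes accessible to the lemmas on \<open>VaR\<close>.\<close>

lemma ES_0: "X \<in> Linf M \<Longrightarrow> ES M 0 X = VaR M 0 X"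
proof -
  assume X: "X \<in> Linf M"
  note X[measurable]
  let ?A = "{m. prob {\<omega> \<in> space M. X \<omega> + m < 0} \<le> 0}"
  have "prob {\<omega> \<in> space M. X \<omega> + m < 0} \<le> 0 \<longleftrightarrow> (AE \<omega> in M. - m \<le> X \<omega>)" for m
  proof -
    have "prob {\<omega> \<in> space M. X \<omega> + m < 0} \<le> 0 \<longleftrightarrow> prob {\<omega> \<in> space M. X \<omega> + m < 0} = 0"
      by (simp add: measure_le_0_iff)
    also have "\<dots> \<longleftrightarrow> (AE \<omega> in M. \<not> X \<omega> + m < 0)"
      by (subst prob_eq_0) auto
    also have "\<dots> \<longleftrightarrow> (AE \<omega> in M. - m \<le> X \<omega>)"
      by (intro arg_cong[where f="almost_everywhere M"] ext) auto
    finally show ?thesis .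
  qed
  \<comment> \<open>Reflection turns the infimum in \<open>VaR\<close> into the supremum in
    \<open>ES\<close>.\<close>
  then have "uminus ` ?A = {m. AE \<omega> in M. m \<le> X \<omega>}"
    by (force simp: image_iff intro: exI[of _ "- x" for x])
  then show ?thesis
    by (simp add: ES_def VaR_def Inf_real_def)
qed

text \<open>The three branches of \<open>ES\<close> are a quantile, a mean and an average of
  quantiles, and each preserves the bounds. This supplies integrability in \<alpha>, the signs of
  \<open>DR\<close> and, with \<open>a = b\<close>, its values at constants.\<close>

lemma ES_bounds:
  assumes X: "X \<in> Linf M" and \<alpha>: "0 \<le> \<alpha>" "\<alpha> \<le> 1"
    and a: "AE \<omega> in M. a \<le> X \<omega>" and b: "AE \<omega> in M. X \<omega> \<le> b"
  shows "ES M \<alpha> X \<in> {- b..- a}"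
proof -
  consider "\<alpha> = 0" | "\<alpha> = 1" | "0 < \<alpha>" "\<alpha> < 1"
    using \<alpha> by linarith
  then show ?thesis
  proof cases
    case 1
    then show ?thesis
      using VaR_bounds[OF X, of 0] a b by (simp add: ES_0 X)
  next
    case 2
    have "integral\<^sup>L M X \<ge> a" "integral\<^sup>L M X \<le> b"
      using X a b by (auto intro!: integral_ge_const integral_le_const Linf_integrable)
    then show ?thesis
      using 2 by (simp add: ES_def)
  next
    case 3
    let ?I = "LBINT \<beta>:{0<..<\<alpha>}. VaR M \<beta> X"
    have const: "set_integrable lborel {0<..<\<alpha>} (\<lambda>_. c)" "(LBINT \<beta>:{0<..<\<alpha>}. c) = \<alpha> * c" for c :: real
      using 3 by (simp_all add: set_integrable_def set_lebesgue_integral_def)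
    have le: "- b \<le> VaR M \<beta> X" "VaR M \<beta> X \<le> - a" if "\<beta> \<in> {0<..<\<alpha>}" for \<beta>
      using VaR_bounds[OF X _ _ a b, of \<beta>] that 3 by auto
    have "(LBINT \<beta>:{0<..<\<alpha>}. - b) \<le> ?I" "?I \<le> (LBINT \<beta>:{0<..<\<alpha>}. - a)"
      using 3 le by (intro set_integral_mono const VaR_set_integrable[OF X]; simp)+
    then have "\<alpha> * - b \<le> ?I" "?I \<le> \<alpha> * - a"
      by (simp_all only: const)
    then show ?thesis
      using 3 by (simp add: ES_def field_simps)
  qed
qed

lemma ES_abs_le:
  assumes "X \<in> Linf M" "0 \<le> \<alpha>" "\<alpha> \<le> 1" "AE \<omega> in M. \<bar>X \<omega>\<bar> \<le> C"
  shows "\<bar>ES M \<alpha> X\<bar> \<le> C"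
proof -
  have "AE \<omega> in M. - C \<le> X \<omega>" "AE \<omega> in M. X \<omega> \<le> C"
    using assms(4) by (auto elim!: eventually_mono)
  from ES_bounds[OF assms(1-3) this] show ?thesis
    by (simp add: abs_le_iff)
qed

text \<open>At level 1 this is linearity of the expectation; below it, additivity of
  \<open>VaR\<close> is used at level 0 or integrated over the levels.\<close>

lemma ES_comonotone_add:
  assumes X: "X \<in> Linf M" and Y: "Y \<in> Linf M" and como: "comonotone M X Y"
    and \<alpha>: "0 \<le> \<alpha>" "\<alpha> \<le> 1"
  shows "ES M \<alpha> (\<lambda>\<omega>. X \<omega> + Y \<omega>) = ES M \<alpha> X + ES M \<alpha> Y"
proof -
  note XY = Linf_add[OF X Y]
  consider "\<alpha> = 0" | "\<alpha> = 1" | "0 < \<alpha>" "\<alpha> < 1"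
    using \<alpha> by linarith
  then show ?thesis
  proof cases
    case 1
    then show ?thesis
      using X Y XY como by (simp add: ES_0 VaR_comonotone_add)
  next
    case 2
    then show ?thesis
      using X Y by (simp add: ES_def Linf_integrable)
  next
    case 3
    have "(LBINT \<beta>:{0<..<\<alpha>}. VaR M \<beta> (\<lambda>\<omega>. X \<omega> + Y \<omega>))
        = (LBINT \<beta>:{0<..<\<alpha>}. VaR M \<beta> X + VaR M \<beta> Y)"
      using 3 by (intro set_lebesgue_integral_cong) (auto simp: VaR_comonotone_add[OF X Y como])
    also have "\<dots> = (LBINT \<beta>:{0<..<\<alpha>}. VaR M \<beta> X) + (LBINT \<beta>:{0<..<\<alpha>}. VaR M \<beta> Y)"
      using 3 X Y by (intro set_integral_add VaR_set_integrable) auto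
    finally show ?thesis
      using 3 by (simp add: ES_def field_simps)
  qed
qed

lemma ES_cmult:
  assumes X: "X \<in> Linf M" and \<alpha>: "0 \<le> \<alpha>" "\<alpha> \<le> 1" and c: "0 < c"
  shows "ES M \<alpha> (\<lambda>\<omega>. c * X \<omega>) = c * ES M \<alpha> X"
proof -
  consider "\<alpha> = 0" | "\<alpha> = 1" | "0 < \<alpha>" "\<alpha> < 1"
    using \<alpha> by linarith
  then show ?thesis
  proof cases
    case 1
    then show ?thesis
      using X c by (simp add: ES_0 VaR_cmult Linf_cmult)
  next
    case 2
    then show ?thesis
      by (simp add: ES_def)
  next
    case 3
    have "(LBINT \<beta>:{0<..<\<alpha>}. VaR M \<beta> (\<lambda>\<omega>. c * X \<omega>)) = (LBINT \<beta>:{0<..<\<alpha>}. c * VaR M \<beta> X)"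
      using 3 by (intro set_lebesgue_integral_cong) (auto simp: VaR_cmult[OF X _ _ c])
    then show ?thesis
      using 3 by (simp add: ES_def)
  qed
qed

lemma ES_measurable:
  assumes X: "X \<in> Linf M"
  shows "(\<lambda>\<alpha>. ES M \<alpha> X) \<in> borel_measurable (restrict_space borel {0..1})"
proof -
  define g where "g = (\<lambda>\<beta>. indicator {0<..<1} \<beta> * VaR M \<beta> X)"
  have [measurable]: "g \<in> borel_measurable borel"
    using VaR_measurable[OF X] by (simp add: g_def borel_measurable_restrict_space_iff)
  \<comment> \<open>The moving endpoint \<alpha> goes into the integrand, making the integral one
    over a fixed space with a jointly measurable integrand. The exceptional levels 0 and 1 are
    constants.\<close>
  define h where "h \<alpha> = (if \<alpha> = 0 then ES M 0 X else if \<alpha> = 1 then ES M 1 X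
    else 1 / \<alpha> * (\<integral>\<beta>. (if 0 < \<beta> \<and> \<beta> < \<alpha> then g \<beta> else 0) \<partial>lborel))" for \<alpha> :: real
  have "h \<in> borel_measurable borel"
    unfolding h_def by measurable
  then have "h \<in> borel_measurable (restrict_space borel {0..1})"
    by (rule measurable_restrict_space1)
  moreover have "ES M \<alpha> X = h \<alpha>" if "\<alpha> \<in> {0..1}" for \<alpha>
  proof (cases "\<alpha> = 0 \<or> \<alpha> = 1")
    case False
    with that have "(\<lambda>\<beta>. indicator {0<..<\<alpha>} \<beta> *\<^sub>R VaR M \<beta> X) = (\<lambda>\<beta>. if 0 < \<beta> \<and> \<beta> < \<alpha> then g \<beta> else 0)"
      by (auto simp: g_def indicator_def)
    with False show ?thesis
      by (simp add: h_def ES_def set_lebesgue_integral_def)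
  qed (auto simp: h_def)
  ultimately show ?thesis
    by (subst measurable_cong[where g=h]) (auto simp: space_restrict_space)
qed

text \<open>This is the Rockafellar-Uryasev formula evaluated at the quantile. Since
  \<open>VaR\<close> decreases in the level, \<open>VaR M \<beta> X - ?q\<close> is nonnegative up
  to \<alpha> and nonpositive beyond. Its positive part therefore extends the integral to all
  levels, where \<open>integral_VaR\<close> turns it into an expectation.\<close>

lemma ES_eq_VaR_plus_excess:
  assumes X: "X \<in> Linf M" and \<alpha>: "0 < \<alpha>" "\<alpha> < 1"
  shows "ES M \<alpha> X = VaR M \<alpha> X + (\<integral>\<omega>. max 0 (- X \<omega> - VaR M \<alpha> X) \<partial>M) / \<alpha>"
proof -
  let ?q = "VaR M \<alpha> X"
  have "(LBINT \<beta>:{0<..<\<alpha>}. VaR M \<beta> X) - \<alpha> * ?q = (LBINT \<beta>:{0<..<\<alpha>}. VaR M \<beta> X - ?q)"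
    using \<alpha> VaR_set_integrable[OF X, of \<alpha>]
    by (subst set_integral_diff) (auto simp: set_integrable_def set_lebesgue_integral_def)
  also have "\<dots> = (LBINT \<beta>:{0<..<1}. max 0 (VaR M \<beta> X - ?q))"
  proof -
    have "indicator {0<..<\<alpha>} \<beta> *\<^sub>R (VaR M \<beta> X - ?q) = indicator {0<..<1} \<beta> *\<^sub>R max 0 (VaR M \<beta> X - ?q)" for \<beta>
      using VaR_antimono[OF X, of \<beta> \<alpha>] VaR_antimono[OF X, of \<alpha> \<beta>] \<alpha>
      by (auto simp: indicator_def max_def)
    then show ?thesis
      by (simp add: set_lebesgue_integral_def)
  qed
  also have "\<dots> = (\<integral>\<omega>. max 0 (- X \<omega> - ?q) \<partial>M)"
    using X by (rule integral_VaR) measurable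
  finally show ?thesis
    using \<alpha> by (simp add: ES_def field_simps)
qed

text \<open>Equality or a reversed inequality would force \<open>X\<close> to equal
  \<open>- VaR\<close> almost surely. At level 0, \<open>X + ?q\<close> is almost surely nonnegative
  with nonpositive mean. At positive levels, the excess over the quantile is compared with its own
  multiple by \<open>1 / \<alpha>\<close>.\<close>

lemma ES_greater_expectation:
  assumes X: "X \<in> Linf M" and \<alpha>: "0 \<le> \<alpha>" "\<alpha> < 1" and nonconst: "\<nexists>c. AE \<omega> in M. X \<omega> = c"
  shows "- (\<integral>\<omega>. X \<omega> \<partial>M) < ES M \<alpha> X"
proof (rule ccontr)
  assume "\<not> ?thesis"
  then have le: "ES M \<alpha> X \<le> - (\<integral>\<omega>. X \<omega> \<partial>M)" by simp
  note X[measurable] Linf_integrable[OF X, simp]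
  show False
  proof (cases "\<alpha> = 0")
    case True
    let ?q = "VaR M 0 X"
    have "prob {\<omega> \<in> space M. X \<omega> + ?q < 0} \<le> 0"
      using VaR_le_iff[OF X, of 0 ?q] by simp
    then have "prob {\<omega> \<in> space M. X \<omega> + ?q < 0} = 0"
      by (simp add: measure_le_0_iff)
    then have AE: "AE \<omega> in M. 0 \<le> X \<omega> + ?q"
      by (subst (asm) prob_eq_0) (auto simp: not_less)
    have "(\<integral>\<omega>. X \<omega> + ?q \<partial>M) \<le> 0"
      using le True by (simp add: ES_0 X prob_space)
    with integral_nonneg_AE[OF AE] have "(\<integral>\<omega>. X \<omega> + ?q \<partial>M) = 0"
      by simp
    then have "AE \<omega> in M. X \<omega> + ?q = 0"
      using AE by (subst (asm) integral_nonneg_eq_0_iff_AE) auto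
    then have "AE \<omega> in M. X \<omega> = - ?q"
      by eventually_elim simp
    with nonconst show False by blast
  next
    case False
    with \<alpha> have \<alpha>: "0 < \<alpha>" "\<alpha> < 1" by auto
    let ?q = "VaR M \<alpha> X"
    let ?h = "\<lambda>\<omega>. max 0 (- X \<omega> - ?q)"
    have int_h: "integrable M ?h"
      by (intro integrable_max) auto
    \<comment> \<open>With \<open>e\<close> the mean of \<open>?h\<close>, the chain is
      \<open>e / \<alpha> \<le> E[- X - ?q] \<le> e\<close>. As \<open>\<alpha> < 1\<close>, it
      gives \<open>e = 0\<close>.\<close>
    have "(\<integral>\<omega>. ?h \<omega> \<partial>M) / \<alpha> \<le> (\<integral>\<omega>. - X \<omega> - ?q \<partial>M)"
      using le ES_eq_VaR_plus_excess[OF X \<alpha>] by (simp add: prob_space)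
    moreover have "(\<integral>\<omega>. - X \<omega> - ?q \<partial>M) \<le> (\<integral>\<omega>. ?h \<omega> \<partial>M)"
      by (intro integral_mono int_h) auto
    moreover have nonneg: "0 \<le> (\<integral>\<omega>. ?h \<omega> \<partial>M)"
      by (intro Bochner_Integration.integral_nonneg) auto
    ultimately have "(\<integral>\<omega>. ?h \<omega> \<partial>M) / \<alpha> \<le> (\<integral>\<omega>. ?h \<omega> \<partial>M)"
      and "0 \<le> (\<integral>\<omega>. - X \<omega> - ?q \<partial>M)"
      using \<alpha> divide_nonneg_pos[of "\<integral>\<omega>. ?h \<omega> \<partial>M" \<alpha>] by linarith+
    moreover from this(1) have "(1 - \<alpha>) * (\<integral>\<omega>. ?h \<omega> \<partial>M) \<le> 0"
      using \<alpha> by (simp add: field_simps)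
    then have "(\<integral>\<omega>. ?h \<omega> \<partial>M) = 0"
      using \<alpha> nonneg by (simp add: mult_le_0_iff)
    \<comment> \<open>The identity \<open>\<bar>z\<bar> = 2 * max 0 z - z\<close> bounds the mean
      absolute deviation from \<open>- ?q\<close> above by \<open>2 * e = 0\<close>.\<close>
    moreover have "(\<integral>\<omega>. \<bar>- X \<omega> - ?q\<bar> \<partial>M) = (\<integral>\<omega>. 2 * ?h \<omega> - (- X \<omega> - ?q) \<partial>M)"
      by (intro Bochner_Integration.integral_cong) (auto simp: max_def abs_if)
    moreover have "\<dots> = 2 * (\<integral>\<omega>. ?h \<omega> \<partial>M) - (\<integral>\<omega>. - X \<omega> - ?q \<partial>M)"
      using int_h by (subst Bochner_Integration.integral_diff) auto
    moreover have "0 \<le> (\<integral>\<omega>. \<bar>- X \<omega> - ?q\<bar> \<partial>M)"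
      by (intro Bochner_Integration.integral_nonneg) auto
    ultimately have "(\<integral>\<omega>. \<bar>- X \<omega> - ?q\<bar> \<partial>M) = 0"
      by simp
    then have "AE \<omega> in M. \<bar>- X \<omega> - ?q\<bar> = 0"
      by (subst (asm) integral_nonneg_eq_0_iff_AE) auto
    then have "AE \<omega> in M. X \<omega> = - ?q"
      by eventually_elim simp
    with nonconst show False by blast
  qed
qed

section \<open>Distortion risk measures\<close>

lemma borel_prob_unit_space:
  assumes "borel_prob_unit \<mu>"
  shows "space \<mu> = {0..1}"
proof -
  have "sets \<mu> = sets (restrict_space borel {0..1})"
    using assms by (simp add: borel_prob_unit_def)
  from sets_eq_imp_space_eq[OF this] show ?thesis
    by (simp add: space_restrict_space)
qed

lemma ES_integrable:
  assumes \<mu>: "borel_prob_unit \<mu>" and X: "X \<in> Linf M"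
  shows "integrable \<mu> (\<lambda>\<alpha>. ES M \<alpha> X)"
proof -
  interpret \<mu>: prob_space \<mu>
    using \<mu> by (simp add: borel_prob_unit_def)
  have sets: "sets \<mu> = sets (restrict_space borel {0..1})"
    using \<mu> by (simp add: borel_prob_unit_def)
  obtain C where C: "AE \<omega> in M. \<bar>X \<omega>\<bar> \<le> C"
    using X by (rule Linf_bounded)
  show ?thesis
  proof (rule \<mu>.integrable_const_bound)
    show "AE \<alpha> in \<mu>. norm (ES M \<alpha> X) \<le> C"
      using ES_abs_le[OF X _ _ C] by (intro AE_I2) (simp add: borel_prob_unit_space[OF \<mu>])
    show "(\<lambda>\<alpha>. ES M \<alpha> X) \<in> borel_measurable \<mu>"
      using ES_measurable[OF X] by (simp cong: measurable_cong_sets add: sets)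
  qed
qed

lemma DR_comonotone_add:
  assumes \<mu>: "borel_prob_unit \<mu>" and XY: "X \<in> Linf M" "Y \<in> Linf M" "comonotone M X Y"
  shows "DR M \<mu> (\<lambda>\<omega>. X \<omega> + Y \<omega>) = DR M \<mu> X + DR M \<mu> Y"
proof -
  have "DR M \<mu> (\<lambda>\<omega>. X \<omega> + Y \<omega>) = (\<integral>\<alpha>. ES M \<alpha> X + ES M \<alpha> Y \<partial>\<mu>)"
    unfolding DR_def using XY
    by (intro Bochner_Integration.integral_cong ES_comonotone_add) (auto simp: borel_prob_unit_space[OF \<mu>])
  then show ?thesis
    using ES_integrable[OF \<mu>] XY by (simp add: DR_def)
qed

lemma DR_cmult:
  assumes \<mu>: "borel_prob_unit \<mu>" and X: "X \<in> Linf M" and c: "0 < c"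
  shows "DR M \<mu> (\<lambda>\<omega>. c * X \<omega>) = c * DR M \<mu> X"
proof -
  have "DR M \<mu> (\<lambda>\<omega>. c * X \<omega>) = (\<integral>\<alpha>. c * ES M \<alpha> X \<partial>\<mu>)"
    unfolding DR_def using X c
    by (intro Bochner_Integration.integral_cong ES_cmult) (auto simp: borel_prob_unit_space[OF \<mu>])
  then show ?thesis
    by (simp add: DR_def)
qed

lemma DR_bounds:
  assumes \<mu>: "borel_prob_unit \<mu>" and X: "X \<in> Linf M"
    and "AE \<omega> in M. a \<le> X \<omega>" "AE \<omega> in M. X \<omega> \<le> b"
  shows "DR M \<mu> X \<in> {- b..- a}"
proof -
  interpret \<mu>: prob_space \<mu>
    using \<mu> by (simp add: borel_prob_unit_def)
  have "AE \<alpha> in \<mu>. ES M \<alpha> X \<in> {- b..- a}"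
    using ES_bounds[OF X _ _ assms(3,4)] by (intro AE_I2) (auto simp: borel_prob_unit_space[OF \<mu>])
  then have "AE \<alpha> in \<mu>. - b \<le> ES M \<alpha> X" "AE \<alpha> in \<mu>. ES M \<alpha> X \<le> - a"
    by auto
  then show ?thesis
    using ES_integrable[OF \<mu> X]
    by (auto simp: DR_def intro!: \<mu>.integral_ge_const \<mu>.integral_le_const)
qed

lemma DR_const: "borel_prob_unit \<mu> \<Longrightarrow> DR M \<mu> (\<lambda>_. c) = - c"
  using DR_bounds[of \<mu> "\<lambda>_. c" c c] by (simp add: Linf_const)

text \<open>Cash additivity is an instance of comonotonic additivity, as constants are comonotone
  with every variable.\<close>

lemma DR_add_const:
  "borel_prob_unit \<mu> \<Longrightarrow> X \<in> Linf M \<Longrightarrow> DR M \<mu> (\<lambda>\<omega>. X \<omega> + c) = DR M \<mu> X - c"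
  by (simp add: DR_comonotone_add Linf_const comonotone_const DR_const)

lemma AE_eq_1_iff:
  assumes \<mu>: "borel_prob_unit \<mu>"
  shows "(AE \<alpha> in \<mu>. \<alpha> = 1) \<longleftrightarrow> measure \<mu> {1} = 1"
proof -
  interpret \<mu>: prob_space \<mu>
    using \<mu> by (simp add: borel_prob_unit_def)
  have "{1} \<in> sets \<mu>"
    using \<mu> by (auto simp: borel_prob_unit_def sets_restrict_space image_iff intro!: bexI[of _ "{1}"])
  from \<mu>.AE_in_set_eq_1[OF this] show ?thesis by simp
qed

lemma DR_eq_expectation:
  assumes \<mu>: "borel_prob_unit \<mu>" and "measure \<mu> {1} = 1" and X: "X \<in> Linf M"
  shows "DR M \<mu> X = - (\<integral>\<omega>. X \<omega> \<partial>M)"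
proof -
  interpret \<mu>: prob_space \<mu>
    using \<mu> by (simp add: borel_prob_unit_def)
  have "AE \<alpha> in \<mu>. \<alpha> = 1"
    using assms by (simp add: AE_eq_1_iff)
  then have "AE \<alpha> in \<mu>. ES M \<alpha> X = ES M 1 X"
    by eventually_elim simp
  then have "DR M \<mu> X = (\<integral>\<alpha>. ES M 1 X \<partial>\<mu>)"
    unfolding DR_def using ES_integrable[OF \<mu> X] by (intro integral_cong_AE) auto
  also have "\<dots> = - (\<integral>\<omega>. X \<omega> \<partial>M)"
    by (simp add: ES_def \<mu>.prob_space)
  finally show ?thesis .
qed

text \<open>Below level 1 both shortfalls strictly exceed the negated means, which cancel, so
  \<open>?f\<close> is positive there; at level 1 it is 0. A nonnegative function with integral 0
  vanishes almost everywhere, which leaves \<mu> no mass below 1.\<close>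

lemma DR_add_DR_uminus_eq_0:
  assumes \<mu>: "borel_prob_unit \<mu>" and X: "X \<in> Linf M"
    and zero: "DR M \<mu> X + DR M \<mu> (\<lambda>\<omega>. - 1 * X \<omega>) = 0" and nonconst: "\<nexists>c. AE \<omega> in M. X \<omega> = c"
  shows "measure \<mu> {1} = 1"
proof -
  note X' = Linf_cmult[OF X, of "- 1"]
  let ?f = "\<lambda>\<alpha>. ES M \<alpha> X + ES M \<alpha> (\<lambda>\<omega>. - 1 * X \<omega>)"
  have nonconst': "\<nexists>c. AE \<omega> in M. - 1 * X \<omega> = c"
  proof
    assume "\<exists>c. AE \<omega> in M. - 1 * X \<omega> = c"
    then obtain c where "AE \<omega> in M. - 1 * X \<omega> = c" ..
    then have "AE \<omega> in M. X \<omega> = - c"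
      by eventually_elim simp
    with nonconst show False by blast
  qed
  have pos: "0 < ?f \<alpha>" if "0 \<le> \<alpha>" "\<alpha> < 1" for \<alpha>
    using ES_greater_expectation[OF X that nonconst] ES_greater_expectation[OF X' that nonconst']
    by simp
  have nonneg: "AE \<alpha> in \<mu>. 0 \<le> ?f \<alpha>"
  proof (rule AE_I2)
    fix \<alpha>
    assume "\<alpha> \<in> space \<mu>"
    then have "0 \<le> \<alpha>" "\<alpha> < 1 \<or> \<alpha> = 1"
      by (auto simp: borel_prob_unit_space[OF \<mu>])
    moreover have "?f 1 = 0"
      by (simp add: ES_def)
    ultimately show "0 \<le> ?f \<alpha>"
      using pos[of \<alpha>] by (metis less_imp_le order_refl)
  qed
  note int = ES_integrable[OF \<mu> X] ES_integrable[OF \<mu> X']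
  have "(\<integral>\<alpha>. ?f \<alpha> \<partial>\<mu>) = 0"
    using zero int by (simp add: DR_def)
  then have "AE \<alpha> in \<mu>. ?f \<alpha> = 0"
    using int nonneg by (subst (asm) integral_nonneg_eq_0_iff_AE) auto
  then have "AE \<alpha> in \<mu>. \<alpha> = 1"
    using AE_space
  proof eventually_elim
    case (elim \<alpha>)
    then show ?case
      using pos[of \<alpha>] by (cases "\<alpha> < 1") (auto simp: borel_prob_unit_space[OF \<mu>])
  qed
  then show ?thesis
    using \<mu> by (simp add: AE_eq_1_iff)
qed

section \<open>Risk measures with a general eligible asset\<close>

text \<open>When investing in the asset shifts \<open>DR\<close> linearly, the acceptable amounts
  form a closed half-line. Both sufficient conditions reduce to this, with \<open>k\<close> the mean
  payoff under (i) and the constant payoff under (ii).\<close>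

lemma S_DR_eq:
  assumes "0 < fst S" "0 < k"
    and "\<And>m. DR M \<mu> (\<lambda>\<omega>. X \<omega> + m / fst S * snd S \<omega>) = DR M \<mu> X - m / fst S * k"
  shows "S_DR M S \<mu> X = fst S / k * DR M \<mu> X"
proof -
  have "DR M \<mu> X - m / fst S * k \<le> 0 \<longleftrightarrow> fst S / k * DR M \<mu> X \<le> m" for m
    using assms(1,2) by (simp add: field_simps)
  then show ?thesis
    by (simp only: S_DR_def assms(3) flip: atLeast_def) simp
qed

lemma comonotonic_S_DR:
  assumes \<mu>: "borel_prob_unit \<mu>" and "0 < fst S" "0 < k"
    and "\<And>X m. X \<in> Linf M \<Longrightarrow>
      DR M \<mu> (\<lambda>\<omega>. X \<omega> + m / fst S * snd S \<omega>) = DR M \<mu> X - m / fst S * k"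
  shows "comonotonic M (S_DR M S \<mu>)"
proof -
  have "S_DR M S \<mu> X = fst S / k * DR M \<mu> X" if "X \<in> Linf M" for X
    using assms that by (intro S_DR_eq)
  then show ?thesis
    by (simp add: comonotonic_def DR_comonotone_add[OF \<mu>] Linf_add add_divide_distrib distrib_left)
qed

text \<open>By positive homogeneity, \<open>DR\<close> along multiples of the payoff is piecewise
  linear, with a possible kink at 0. A constant \<open>c \<le> 0\<close> is offset by a long
  position (slope \<open>- a\<close>), a positive one allows a short position (slope
  \<open>- b\<close>). The kink is what comonotonicity detects.\<close>

lemma S_DR_const:
  assumes \<mu>: "borel_prob_unit \<mu>" and S0: "0 < fst S" and Z: "snd S \<in> Linf M"
    and neg: "DR M \<mu> (snd S) < 0" and pos: "0 < DR M \<mu> (\<lambda>\<omega>. - 1 * snd S \<omega>)"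
  shows "S_DR M S \<mu> (\<lambda>_. c) =
    - (c * fst S) / (if c \<le> 0 then - DR M \<mu> (snd S) else DR M \<mu> (\<lambda>\<omega>. - 1 * snd S \<omega>))"
proof -
  note Z' = Linf_cmult[OF Z, of "- 1"]
  define a where "a = - DR M \<mu> (snd S)"
  define b where "b = DR M \<mu> (\<lambda>\<omega>. - 1 * snd S \<omega>)"
  have ab: "0 < a" "0 < b"
    using neg pos by (simp_all add: a_def b_def)
  have scale: "DR M \<mu> (\<lambda>\<omega>. t * snd S \<omega>) = - (if 0 \<le> t then a else b) * t" for t
  proof -
    consider "t = 0" | "0 < t" | "t < 0" by linarith
    then show ?thesis
    proof cases
      case 1
      then show ?thesis using DR_const[OF \<mu>, of 0] by simp
    next
      case 2
      then show ?thesis by (simp add: DR_cmult[OF \<mu> Z] a_def)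
    next
      case 3
      have "DR M \<mu> (\<lambda>\<omega>. t * snd S \<omega>) = DR M \<mu> (\<lambda>\<omega>. - t * (- 1 * snd S \<omega>))"
        by simp
      also have "\<dots> = - t * b"
        unfolding b_def using 3 by (intro DR_cmult[OF \<mu> Z']) simp
      finally show ?thesis using 3 by simp
    qed
  qed
  have "DR M \<mu> (\<lambda>\<omega>. c + m / fst S * snd S \<omega>) \<le> 0
      \<longleftrightarrow> - (c * fst S) / (if c \<le> 0 then a else b) \<le> m" for m
  proof -
    have "DR M \<mu> (\<lambda>\<omega>. c + m / fst S * snd S \<omega>) = DR M \<mu> (\<lambda>\<omega>. m / fst S * snd S \<omega>) - c"
      using DR_add_const[OF \<mu> Linf_cmult[OF Z], of "m / fst S" c] by (simp only: add.commute)
    also have "\<dots> = - (if 0 \<le> m then a * m else b * m) / fst S - c"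
      using S0 by (subst scale) (simp add: zero_le_divide_iff)
    finally have "DR M \<mu> (\<lambda>\<omega>. c + m / fst S * snd S \<omega>) \<le> 0
        \<longleftrightarrow> - (if 0 \<le> m then a * m else b * m) \<le> c * fst S"
      by (simp only: diff_le_eq add_0 pos_divide_le_eq[OF S0])
    \<comment> \<open>The slope is now chosen by the sign of \<open>c\<close> instead of that of
      \<open>m\<close>. Where the two choices differ, the inequalities both hold
      (\<open>0 \<le> m\<close>, \<open>0 < c\<close>) or both fail (\<open>m < 0\<close>,
      \<open>c \<le> 0\<close>) by sign alone.\<close>
    also have "\<dots> \<longleftrightarrow> - (c * fst S) \<le> (if c \<le> 0 then a * m else b * m)"
    proof (cases "0 \<le> m"; cases "c \<le> 0")
      assume "0 \<le> m" "\<not> c \<le> 0"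
      then have "0 \<le> a * m" "0 \<le> b * m" "0 < c * fst S"
        using ab S0 by simp_all
      then show ?thesis by auto
    next
      assume "\<not> 0 \<le> m" "c \<le> 0"
      then have "a * m < 0" "b * m < 0" "c * fst S \<le> 0"
        using ab S0 by (simp_all add: mult_pos_neg mult_nonpos_nonneg)
      then show ?thesis by auto
    qed auto
    also have "\<dots> \<longleftrightarrow> - (c * fst S) / (if c \<le> 0 then a else b) \<le> m"
      by (simp only: pos_divide_le_eq ab mult.commute split: if_split) simp
    finally show ?thesis .
  qed
  then show ?thesis
    unfolding S_DR_def a_def b_def by (simp only: flip: atLeast_def) simp
qed

section \<open>Necessity and sufficiency of the two conditions\<close>

lemma risk_free_or_measure_1_if_comonotonic:
  assumes \<mu>: "borel_prob_unit \<mu>" and S: "eligible_asset M S"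
    and como: "comonotonic M (S_DR M S \<mu>)"
  shows "measure \<mu> {1} = 1 \<or> risk_free M S"
proof -
  have S0: "0 < fst S" and Z: "snd S \<in> Linf M"
    using S by (auto simp: eligible_asset_def Linf_plus_def)
  note Z' = Linf_cmult[OF Z, of "- 1"]
  obtain \<epsilon> where \<epsilon>: "0 < \<epsilon>" and lower: "AE \<omega> in M. \<epsilon> \<le> snd S \<omega>"
    using S by (auto simp: eligible_asset_def)
  obtain C where C: "AE \<omega> in M. \<bar>snd S \<omega>\<bar> \<le> C"
    using Z by (rule Linf_bounded)
  \<comment> \<open>The payoff is at least \<epsilon>, so \<open>DR\<close> is at most
    \<open>- \<epsilon>\<close> at the payoff and at least \<epsilon> at its negative.\<close>
  have "AE \<omega> in M. snd S \<omega> \<le> C" "AE \<omega> in M. - C \<le> - 1 * snd S \<omega>" "AE \<omega> in M. - 1 * snd S \<omega> \<le> - \<epsilon>"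
    using C lower by auto
  from DR_bounds[OF \<mu> Z lower this(1)] DR_bounds[OF \<mu> Z' this(2,3)] \<epsilon>
  have sign: "DR M \<mu> (snd S) < 0" "0 < DR M \<mu> (\<lambda>\<omega>. - 1 * snd S \<omega>)"
    by simp_all
  have "S_DR M S \<mu> (\<lambda>_. 1 + - 1) = S_DR M S \<mu> (\<lambda>_. 1) + S_DR M S \<mu> (\<lambda>_. - 1)"
    using como[unfolded comonotonic_def, rule_format, OF Linf_const Linf_const comonotone_const] .
  \<comment> \<open>The values at the constants 0, 1 and -1 are 0, \<open>- fst S / DR(- S1)\<close>
    and \<open>fst S / - DR(S1)\<close>, with \<open>S1\<close> for \<open>snd S\<close>.\<close>
  then have "fst S / - DR M \<mu> (snd S) = fst S / DR M \<mu> (\<lambda>\<omega>. - 1 * snd S \<omega>)"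
    using S_DR_const[OF \<mu> S0 Z sign, of 0] S_DR_const[OF \<mu> S0 Z sign, of 1]
      S_DR_const[OF \<mu> S0 Z sign, of "- 1"] by simp
  then have "DR M \<mu> (snd S) + DR M \<mu> (\<lambda>\<omega>. - 1 * snd S \<omega>) = 0"
    using S0 unfolding divide_cancel_left by linarith
  then show ?thesis
    using DR_add_DR_uminus_eq_0[OF \<mu> Z] by (auto simp: risk_free_def)
qed

text \<open>Here \<open>DR\<close> is minus the expectation, so linearity gives the slope
  \<open>k = E[snd S]\<close>, positive because the payoff is at least \<epsilon>.\<close>

lemma comonotonic_if_measure_1:
  assumes \<mu>: "borel_prob_unit \<mu>" and S: "eligible_asset M S" and one: "measure \<mu> {1} = 1"
  shows "comonotonic M (S_DR M S \<mu>)"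
proof -
  have S0: "0 < fst S" and Z: "snd S \<in> Linf M"
    using S by (auto simp: eligible_asset_def Linf_plus_def)
  obtain \<epsilon> where \<epsilon>: "0 < \<epsilon>" "AE \<omega> in M. \<epsilon> \<le> snd S \<omega>"
    using S by (auto simp: eligible_asset_def)
  have "\<epsilon> \<le> (\<integral>\<omega>. snd S \<omega> \<partial>M)"
    using \<epsilon> Z by (intro integral_ge_const Linf_integrable)
  with \<epsilon>(1) have "0 < (\<integral>\<omega>. snd S \<omega> \<partial>M)"
    by linarith
  with \<mu> S0 show ?thesis
  proof (rule comonotonic_S_DR)
    fix X m
    assume X: "X \<in> Linf M"
    then show "DR M \<mu> (\<lambda>\<omega>. X \<omega> + m / fst S * snd S \<omega>)
        = DR M \<mu> X - m / fst S * (\<integral>\<omega>. snd S \<omega> \<partial>M)"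
      using Bochner_Integration.integral_add[OF Linf_integrable[OF X]
          Linf_integrable[OF Linf_cmult[OF Z]], of "m / fst S"] Z
      by (simp only: DR_eq_expectation[OF \<mu> one] Linf_add Linf_cmult integral_mult_right_zero)
  qed
qed

lemma comonotonic_if_risk_free:
  assumes \<mu>: "borel_prob_unit \<mu>" and S: "eligible_asset M S" and "risk_free M S"
  shows "comonotonic M (S_DR M S \<mu>)"
proof -
  have S0: "0 < fst S" and Z: "snd S \<in> Linf M"
    using S by (auto simp: eligible_asset_def Linf_plus_def)
  obtain c where c: "AE \<omega> in M. snd S \<omega> = c"
    using assms(3) by (auto simp: risk_free_def)
  obtain \<epsilon> where \<epsilon>: "0 < \<epsilon>" "AE \<omega> in M. \<epsilon> \<le> snd S \<omega>"
    using S by (auto simp: eligible_asset_def)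
  from \<epsilon>(2) c have "AE \<omega> in M. \<epsilon> \<le> c"
    by eventually_elim simp
  \<comment> \<open>An almost sure statement that does not mention \<omega> holds outright, since a
    probability measure is not zero.\<close>
  then have "0 < c"
    using \<epsilon>(1) by simp
  with \<mu> S0 show ?thesis
  proof (rule comonotonic_S_DR)
    fix X m
    assume X: "X \<in> Linf M"
    note X[measurable] Z[measurable]
    \<comment> \<open>Replacing the payoff by the constant \<open>c\<close> turns the investment
      into cash, and cash additivity gives the slope \<open>k = c\<close>.\<close>
    have "ES M \<alpha> (\<lambda>\<omega>. X \<omega> + m / fst S * snd S \<omega>) = ES M \<alpha> (\<lambda>\<omega>. X \<omega> + m / fst S * c)" for \<alpha>
      by (rule ES_cong_AE) (use c in auto)
    then have "DR M \<mu> (\<lambda>\<omega>. X \<omega> + m / fst S * snd S \<omega>) = DR M \<mu> (\<lambda>\<omega>. X \<omega> + m / fst S * c)"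
      by (simp add: DR_def)
    then show "DR M \<mu> (\<lambda>\<omega>. X \<omega> + m / fst S * snd S \<omega>) = DR M \<mu> X - m / fst S * c"
      using \<mu> X by (simp only: DR_add_const)
  qed
qed

end

theorem proposition3p10:
  fixes M :: "'a measure" and \<mu> :: "real measure" and S :: "real \<times> ('a \<Rightarrow> real)"
  assumes "prob_space M"
    and "borel_prob_unit \<mu>"
    and "eligible_asset M S"
  shows "(comonotonic M (S_DR M S \<mu>) \<longleftrightarrow> measure \<mu> {1} = 1 \<or> risk_free M S)
    \<and> (measure \<mu> {1} = 1 \<longrightarrow> (\<forall>X \<in> Linf M. DR M \<mu> X = - (\<integral>\<omega>. X \<omega> \<partial>M)))"
proof -
  interpret prob_space M by fact
  show ?thesis
    using risk_free_or_measure_1_if_comonotonic[OF assms(2,3)] DR_eq_expectation[OF assms(2)]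
      comonotonic_if_measure_1[OF assms(2,3)] comonotonic_if_risk_free[OF assms(2,3)] by blast
qed

end
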